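(* Consider a linear program $\max\{b^Ty : Ay\le c,\ y\ge0,\ y\in\mathbb{R}^m\}$ satisfying the standing assumptions listed in the context, with optimal value $\mathrm{OPT}$ and bounds $R$, $r$. Let $\alpha\in[-R,R]$, $\varepsilon>0$, and set $\varepsilon'''=\varepsilon/(6R(r+1))$. Let $\lambda^*$ be the value of the zero-sum game with payoff matrix $$A'''=\begin{pmatrix} e^T & 1 & -1\\ -e^T & -1 & 1\\ -b^T & 0 & \alpha/R\\ A & 0 & -c/R\end{pmatrix}\in\mathbb{R}^{(n+3)\times(m+2)},$$ that is, $\lambda^*=\min\{\lambda\in\mathbb{R} : A'''y'''\le\lambda e \text{ for some } y'''\in\Delta^{m+2}\}$. Then finding $\lambda^*$ up to additive error $\varepsilon'''$ suffices to correctly conclude either $\mathrm{OPT}<\alpha$ or $\mathrm{OPT}\ge\alpha-\varepsilon$; that is, there is a decision rule depending only on $\varepsilon'''$ and a number $\tilde\lambda$ which, whenever $|\tilde\lambda-\lambda^*|\le\varepsilon'''$, outputs one of the two assertions "$\mathrm{OPT}<\alpha$" or "$\mathrm{OPT}\ge\alpha-\varepsilon$", and the asserted inequality is true.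
   Context: Setting. $A\in\mathbb{R}^{n\times m}$, $b\in\mathbb{R}^m$, $c\in\mathbb{R}^n$. The primal LP is $\max\{b^Ty: Ay\le c,\ y\ge0\}$ and its dual is $\min\{c^Tx: A^Tx\ge b,\ x\ge0\}$. Standing assumptions. All entries of $A$, $b$, $c$ lie in $[-1,1]$. The primal and dual are feasible. A constant $R>0$ is known such that adding the constraint $\sum_{j=1}^m y_j\le R$ to the primal does not change its optimal value, and a constant $r\ge0$ is known such that adding the constraint $\sum_{i=1}^n x_i\le r$ to the dual does not change its optimal value. In particular the two optimal values coincide and are finite; the common value is denoted $\mathrm{OPT}$ (and $-R\le\mathrm{OPT}\le R$). Moreover $|c_i|\le R$ for all $i\in[n]$. Notation. $e$ denotes the all-one vector (of the dimension clear from context; in the block matrix $e^T$ and $b^T$ are rows of length $m$), and $\Delta^k$ is the set of non-negative vectors in $\mathbb{R}^k$ whose entries sum to $1$. Vector inequalities are entrywise. *)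

theory Defs
  imports "Jordan_Normal_Form.Matrix" "HOL-Library.Extended_Real"
begin

text \<open>
  Linear programs \<open>max {b\<^sup>T y : A y \<le> c, y \<ge> 0}\<close> with dual \<open>min {c\<^sup>T x : A\<^sup>T x \<ge> b, x \<ge> 0}\<close>, where
  \<open>A\<close> is \<open>n \<times> m\<close>. On vectors, \<open>\<le>\<close> is entrywise and includes equality of dimensions.
\<close>

definition primal_feasible :: "real mat \<Rightarrow> real vec \<Rightarrow> real vec set" where
  "primal_feasible A c = {y \<in> carrier_vec (dim_col A). A *\<^sub>v y \<le> c \<and> 0\<^sub>v (dim_col A) \<le> y}"

definition dual_feasible :: "real mat \<Rightarrow> real vec \<Rightarrow> real vec set" where
  "dual_feasible A b = {x \<in> carrier_vec (dim_row A). b \<le> A\<^sup>T *\<^sub>v x \<and> 0\<^sub>v (dim_row A) \<le> x}"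

definition entry_sum :: "real vec \<Rightarrow> real" where
  "entry_sum v = (\<Sum>i<dim_vec v. v $ i)"

text \<open>
  Optimal values are extended reals, so that an infeasible maximisation (minimisation) problem has
  value \<open>-\<infinity>\<close> (\<open>\<infinity>\<close>). The \<open>bounded\<close> variants add a bound on the sum of the entries.
\<close>

definition primal_value :: "real mat \<Rightarrow> real vec \<Rightarrow> real vec \<Rightarrow> ereal" where
  "primal_value A b c = (SUP y \<in> primal_feasible A c. ereal (b \<bullet> y))"

definition dual_value :: "real mat \<Rightarrow> real vec \<Rightarrow> real vec \<Rightarrow> ereal" where
  "dual_value A b c = (INF x \<in> dual_feasible A b. ereal (c \<bullet> x))"

definition bounded_primal_value :: "real mat \<Rightarrow> real vec \<Rightarrow> real vec \<Rightarrow> real \<Rightarrow> ereal" where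
  "bounded_primal_value A b c R =
     (SUP y \<in> {y \<in> primal_feasible A c. entry_sum y \<le> R}. ereal (b \<bullet> y))"

definition bounded_dual_value :: "real mat \<Rightarrow> real vec \<Rightarrow> real vec \<Rightarrow> real \<Rightarrow> ereal" where
  "bounded_dual_value A b c r =
     (INF x \<in> {x \<in> dual_feasible A b. entry_sum x \<le> r}. ereal (c \<bullet> x))"

definition lp_assumptions ::
    "nat \<Rightarrow> nat \<Rightarrow> real mat \<Rightarrow> real vec \<Rightarrow> real vec \<Rightarrow> real \<Rightarrow> real \<Rightarrow> bool" where
  "lp_assumptions n m A b c R r \<longleftrightarrow>
     A \<in> carrier_mat n m \<and> b \<in> carrier_vec m \<and> c \<in> carrier_vec n \<and>
     (\<forall>i<n. \<forall>j<m. A $$ (i, j) \<in> {-1..1}) \<and>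
     (\<forall>j<m. b $ j \<in> {-1..1}) \<and>
     (\<forall>i<n. c $ i \<in> {-1..1}) \<and>
     primal_feasible A c \<noteq> {} \<and> dual_feasible A b \<noteq> {} \<and>
     0 < R \<and> bounded_primal_value A b c R = primal_value A b c \<and>
     0 \<le> r \<and> bounded_dual_value A b c r = dual_value A b c \<and>
     (\<forall>i<n. \<bar>c $ i\<bar> \<le> R)"

definition all_ones :: "nat \<Rightarrow> real vec" where
  "all_ones k = vec k (\<lambda>_. 1)"

definition prob_simplex :: "nat \<Rightarrow> real vec set" where
  "prob_simplex k = {y \<in> carrier_vec k. 0\<^sub>v k \<le> y \<and> entry_sum y = 1}"

text \<open>
  The least \<open>\<lambda>\<close> such that \<open>M y \<le> \<lambda> e\<close> for some mixed strategy \<open>y\<close>. By compactness the minimum is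
  attained whenever \<open>M\<close> has at least one row and one column.
\<close>

definition game_value :: "real mat \<Rightarrow> real" where
  "game_value M =
     (LEAST l. \<exists>y \<in> prob_simplex (dim_col M). M *\<^sub>v y \<le> l \<cdot>\<^sub>v all_ones (dim_row M))"

definition lp_game_matrix :: "real mat \<Rightarrow> real vec \<Rightarrow> real vec \<Rightarrow> real \<Rightarrow> real \<Rightarrow> real mat" where
  "lp_game_matrix A b c R \<alpha> =
     (let n = dim_row A; m = dim_col A; e = all_ones m in
      mat_of_rows (m + 2)
        ([   e @\<^sub>v vec_of_list [ 1, -1],
          (-e) @\<^sub>v vec_of_list [-1,  1],
          (-b) @\<^sub>v vec_of_list [ 0, \<alpha> / R]] @
         map (\<lambda>i. row A i @\<^sub>v vec_of_list [0, - (c $ i) / R]) [0..<n]))"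

end

theory Submission
  imports Defs
begin

text \<open>
  The decision rule answers \<open>OPT < \<alpha>\<close> iff the approximate value exceeds \<open>\<delta> = \<epsilon>'''\<close>. If
  \<open>OPT \<ge> \<alpha>\<close>, then scaling near-optimal \<open>y\<close> with entry sum at most \<open>R\<close> by \<open>1/(2R)\<close> and giving the
  last column probability \<open>1/2\<close> shows that the game value is at most \<open>0\<close>. Conversely, let the game
  value be at most \<open>v = 2\<delta>\<close>, attained at \<open>(y, s, t)\<close>; the first two rows force \<open>\<bar>1 - 2t\<bar> \<le> v\<close>.
  Pairing the rows of \<open>A\<close> with a dual feasible \<open>x\<close> of entry sum at most \<open>r\<close> gives
  \<open>(\<alpha> - c\<^sup>T x) t \<le> R (r + 1) v\<close>. For \<open>t \<ge> 1/3\<close> this is \<open>c\<^sup>T x \<ge> \<alpha> - 3R(r + 1)v = \<alpha> - \<epsilon>\<close>; for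
  \<open>t < 1/3\<close> we have \<open>v > 1/3\<close>, so \<open>\<alpha> - \<epsilon> \<le> R - R(r + 1) = -Rr \<le> c\<^sup>T x\<close>. Strong duality transfers
  the bound to the primal. Strong duality and the attainment of the game value both come from
  Farkas' lemma, obtained by Fourier-Motzkin elimination.
\<close>

section \<open>Fourier-Motzkin elimination and Farkas' lemma\<close>

text \<open>A pair \<open>(a, d)\<close> encodes the inequality \<open>\<Sum>j a j * y j \<le> d\<close>; the cone collects its consequences.\<close>

inductive_set cone :: "((nat \<Rightarrow> real) \<times> real) set \<Rightarrow> ((nat \<Rightarrow> real) \<times> real) set"
  for S where
    base: "s \<in> S \<Longrightarrow> s \<in> cone S"
  | comb: "(a, d) \<in> cone S \<Longrightarrow> (a', d') \<in> cone S \<Longrightarrow> 0 \<le> p \<Longrightarrow> 0 \<le> q \<Longrightarrow>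
      (\<lambda>j. p * a j + q * a' j, p * d + q * d') \<in> cone S"

lemma cone_subset:
  assumes "S' \<subseteq> cone S" shows "cone S' \<subseteq> cone S"
proof
  fix s assume "s \<in> cone S'"
  then show "s \<in> cone S"
  proof induction
    case (base s)
    with assms show ?case by blast
  next
    case (comb a d a' d' p q)
    from comb.IH comb.hyps(3,4) show ?case by (rule cone.comb)
  qed
qed

text \<open>Supplies the value of an eliminated variable between its lower and upper bounds. Either
  set may be empty, so \<open>Max L\<close> or \<open>Min U\<close> is chosen according to which one
  exists.\<close>

lemma separating_real:
  fixes L U :: "real set"
  assumes "finite L" "finite U" "\<And>l u. l \<in> L \<Longrightarrow> u \<in> U \<Longrightarrow> l \<le> u"
  obtains z where "\<And>l. l \<in> L \<Longrightarrow> l \<le> z" "\<And>u. u \<in> U \<Longrightarrow> z \<le> u"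
proof (cases "L = {}")
  case True
  show ?thesis
  proof (cases "U = {}")
    case True
    with \<open>L = {}\<close> that show ?thesis by auto
  next
    case False
    with assms True show ?thesis by (intro that[of "Min U"]) auto
  qed
next
  case False
  with assms show ?thesis by (intro that[of "Max L"]) auto
qed

text \<open>Induction on the number of variables: the last variable is eliminated by cancelling it
  between every inequality where its coefficient is positive and every one where it is negative. The
  new inequalities are consequences of the old, so a contradictory consequence found later lies in
  the original cone.\<close>

lemma fourier_motzkin:
  assumes "finite S"
    and "\<not> (\<exists>y. \<forall>(a, d) \<in> S. (\<Sum>j<m. a j * y j) \<le> d)"
  shows "\<exists>(a, d) \<in> cone S. (\<forall>j<m. a j = 0) \<and> d < 0"
  using assms
proof (induction m arbitrary: S)
  case 0
  then obtain a d where "(a, d) \<in> S" "d < 0" by force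
  then show ?case by (auto intro!: bexI[of _ "(a, d)"] cone.base)
next
  case (Suc m)
  define Z where "Z = {s \<in> S. fst s m = 0}"
  define P where "P = {s \<in> S. fst s m > 0}"
  define N where "N = {s \<in> S. fst s m < 0}"
  \<comment> \<open>Both multipliers are positive for \<open>s\<close> in \<open>P\<close> and
    \<open>t\<close> in \<open>N\<close>, and the coefficient at \<open>m\<close> cancels.\<close>
  define f where "f = (\<lambda>(s, t). (\<lambda>j. (- fst t m) * fst s j + fst s m * fst t j,
      (- fst t m) * snd s + fst s m * snd t) :: (nat \<Rightarrow> real) \<times> real)"
  define S' where "S' = Z \<union> f ` (P \<times> N)"
  have fin: "finite Z" "finite P" "finite N" "finite S'"
    using Suc.prems(1) by (auto simp: Z_def P_def N_def S'_def)
  have "f (s, t) \<in> cone S" if "s \<in> P" "t \<in> N" for s t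
    using cone.comb[OF cone.base[of "(fst s, snd s)"] cone.base[of "(fst t, snd t)"],
        of S "- fst t m" "fst s m"] that
    by (simp add: f_def P_def N_def)
  then have sub: "S' \<subseteq> cone S"
    by (auto simp: S'_def Z_def intro: cone.base)
  \<comment> \<open>The induction hypothesis controls only the coefficients below \<open>m\<close>;
    this fact covers index \<open>m\<close> itself.\<close>
  have zero: "fst s m = 0" if "s \<in> cone S'" for s
    using that by induction (auto simp: S'_def Z_def f_def)
  have "\<not> (\<exists>y. \<forall>(a, d) \<in> S'. (\<Sum>j<m. a j * y j) \<le> d)"
  proof
    assume "\<exists>y. \<forall>(a, d) \<in> S'. (\<Sum>j<m. a j * y j) \<le> d"
    then obtain y where y: "\<And>s. s \<in> S' \<Longrightarrow> (\<Sum>j<m. fst s j * y j) \<le> snd s" by fastforce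
    \<comment> \<open>Solving an inequality for variable \<open>m\<close> gives this bound, an upper
      one on \<open>P\<close> and a lower one on \<open>N\<close>.\<close>
    define g where "g = (\<lambda>s. (snd s - (\<Sum>j<m. fst s j * y j)) / fst s m)"
    have le: "g t \<le> g s" if "t \<in> N" "s \<in> P" for t s
    proof -
      have "f (s, t) \<in> S'" using that by (auto simp: S'_def)
      from y[OF this]
      have "- fst t m * (\<Sum>j<m. fst s j * y j) + fst s m * (\<Sum>j<m. fst t j * y j)
          \<le> - fst t m * snd s + fst s m * snd t"
        by (simp add: f_def sum.distrib sum_subtractf sum_negf sum_distrib_left algebra_simps)
      moreover have "fst s m > 0" "fst t m < 0" using that by (auto simp: P_def N_def)
      ultimately have
        "(snd s - (\<Sum>j<m. fst s j * y j)) * fst t m \<le> (snd t - (\<Sum>j<m. fst t j * y j)) * fst s m"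
        by (simp add: algebra_simps)
      then have
        "(snd s - (\<Sum>j<m. fst s j * y j)) * fst t m / fst s m \<le> snd t - (\<Sum>j<m. fst t j * y j)"
        using that by (simp add: P_def pos_divide_le_eq)
      then show ?thesis
        unfolding g_def using that by (simp add: N_def neg_divide_le_eq times_divide_eq_left)
    qed
    obtain z where z: "\<And>t. t \<in> N \<Longrightarrow> g t \<le> z" "\<And>s. s \<in> P \<Longrightarrow> z \<le> g s"
    proof (rule separating_real[of "g ` N" "g ` P"])
      fix z assume "\<And>l. l \<in> g ` N \<Longrightarrow> l \<le> z" "\<And>u. u \<in> g ` P \<Longrightarrow> z \<le> u"
      then show thesis by (intro that[of z]) auto
    qed (use fin le in auto)
    have "(\<Sum>j<Suc m. fst s j * (y(m := z)) j) \<le> snd s" if "s \<in> S" for s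
    proof -
      consider "s \<in> Z" | "s \<in> P" | "s \<in> N" using \<open>s \<in> S\<close> by (force simp: Z_def P_def N_def)
      then have "(\<Sum>j<m. fst s j * y j) + fst s m * z \<le> snd s"
      proof cases
        case 1
        then show ?thesis using y[of s] by (auto simp: S'_def Z_def)
      next
        case 2
        then show ?thesis using z(2)[of s] by (simp add: g_def P_def field_simps)
      next
        case 3
        then show ?thesis using z(1)[of s] by (simp add: g_def N_def field_simps)
      qed
      then show ?thesis by simp
    qed
    with Suc.prems(2) show False unfolding case_prod_beta by blast
  qed
  from Suc.IH[OF fin(4) this] obtain a d where ad: "(a, d) \<in> cone S'" "\<forall>j<m. a j = 0" "d < 0"
    by auto
  have "\<forall>j<Suc m. a j = 0" using ad(2) zero[OF ad(1)] by (simp add: less_Suc_eq)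
  moreover have "(a, d) \<in> cone S" using ad(1) cone_subset[OF sub] by blast
  ultimately show ?case using ad(3) by blast
qed

text \<open>Elimination is applied to the rows together with the sign constraints
  \<open>- y j \<le> 0\<close>. Discarding the multipliers of the sign constraints turns the
  vanishing of the combined coefficients into nonnegativity.\<close>

lemma farkas:
  fixes A :: "nat \<Rightarrow> nat \<Rightarrow> real" and c :: "nat \<Rightarrow> real"
  assumes "\<not> (\<exists>y. (\<forall>j<m. 0 \<le> y j) \<and> (\<forall>i<n. (\<Sum>j<m. A i j * y j) \<le> c i))"
  obtains x where "\<And>i. i < n \<Longrightarrow> 0 \<le> x i" "\<And>j. j < m \<Longrightarrow> 0 \<le> (\<Sum>i<n. x i * A i j)"
    "(\<Sum>i<n. x i * c i) < 0"
proof -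
  define S where "S = (\<lambda>i. (A i, c i)) ` {..<n} \<union>
    (\<lambda>j. (\<lambda>k. if k = j then -1 else 0, 0)) ` {..<m}"
  have "\<not> (\<exists>y. \<forall>(a, d) \<in> S. (\<Sum>j<m. a j * y j) \<le> d)"
  proof
    assume "\<exists>y. \<forall>(a, d) \<in> S. (\<Sum>j<m. a j * y j) \<le> d"
    then obtain y where y: "\<And>a d. (a, d) \<in> S \<Longrightarrow> (\<Sum>j<m. a j * y j) \<le> d" by blast
    have "0 \<le> y j" if "j < m" for j
      using y[of "\<lambda>k. if k = j then -1 else 0" 0] that
      by (auto simp: S_def if_distrib[of "\<lambda>x. x * _"] cong: if_cong)
    moreover have "(\<Sum>j<m. A i j * y j) \<le> c i" if "i < n" for i
      using y[of "A i" "c i"] that by (auto simp: S_def)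
    ultimately show False using assms by blast
  qed
  then obtain a d where ad: "(a, d) \<in> cone S" "\<forall>j<m. a j = 0" "d < 0"
    using fourier_motzkin[of S m] by (auto simp: S_def)
  \<comment> \<open>Only an upper bound on \<open>fst s j\<close> is invariant, because a sign
    constraint lowers a coefficient and leaves the right-hand side unchanged.\<close>
  have "\<exists>x. (\<forall>i<n. 0 \<le> x i) \<and> (\<forall>j<m. fst s j \<le> (\<Sum>i<n. x i * A i j)) \<and>
      snd s = (\<Sum>i<n. x i * c i)" if "s \<in> cone S" for s
    using that
  proof induction
    case (base s)
    then consider i where "i < n" "s = (A i, c i)"
      | j where "j < m" "s = (\<lambda>k. if k = j then -1 else 0, 0)"
      by (auto simp: S_def)
    then show ?case
    proof cases
      case 1
      then show ?thesis
        by (intro exI[of _ "\<lambda>k. if k = i then 1 else 0"])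
          (auto simp: if_distrib[of "\<lambda>x. x * _"] cong: if_cong)
    next
      case 2
      then show ?thesis by (intro exI[of _ "\<lambda>_. 0"]) auto
    qed
  next
    case (comb a d a' d' p q)
    then obtain x x' where x: "\<forall>i<n. 0 \<le> x i" "\<forall>j<m. a j \<le> (\<Sum>i<n. x i * A i j)"
        "d = (\<Sum>i<n. x i * c i)"
      and x': "\<forall>i<n. 0 \<le> x' i" "\<forall>j<m. a' j \<le> (\<Sum>i<n. x' i * A i j)"
        "d' = (\<Sum>i<n. x' i * c i)"
      by auto
    have *: "(\<Sum>i<n. (p * x i + q * x' i) * B i) =
        p * (\<Sum>i<n. x i * B i) + q * (\<Sum>i<n. x' i * B i)" for B :: "nat \<Rightarrow> real"
      by (simp add: sum.distrib sum_distrib_left algebra_simps)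
    show ?case
      by (rule exI[of _ "\<lambda>i. p * x i + q * x' i"])
        (use x x' comb.hyps in \<open>auto simp: * intro!: add_mono mult_left_mono\<close>)
  qed
  from this[OF ad(1)] obtain x where x: "\<forall>i<n. 0 \<le> x i"
    "\<forall>j<m. a j \<le> (\<Sum>i<n. x i * A i j)" "d = (\<Sum>i<n. x i * c i)"
    by auto
  show ?thesis
  proof (rule that)
    show "0 \<le> (\<Sum>i<n. x i * A i j)" if "j < m" for j
      using x(2) ad(2) that by metis
  qed (use x ad(3) in auto)
qed

section \<open>Linear programs in coordinates and strong duality\<close>

lemma sum_bilinear_swap:
  fixes x y :: "nat \<Rightarrow> real"
  shows "(\<Sum>j<m. (\<Sum>i<n. x i * A i j) * y j) = (\<Sum>i<n. x i * (\<Sum>j<m. A i j * y j))"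
  by (simp add: sum_distrib_left sum_distrib_right sum.swap[of _ "{..<n}"] mult.assoc)

lemma mult_mat_vec_nth:
  assumes "A \<in> carrier_mat n m" "y \<in> carrier_vec m" "i < n"
  shows "(A *\<^sub>v y) $ i = (\<Sum>j<m. A $$ (i, j) * y $ j)"
  using assms by (auto simp: scalar_prod_def atLeast0LessThan intro!: sum.cong)

lemma transpose_mult_vec_nth:
  fixes A :: "real mat"
  assumes "A \<in> carrier_mat n m" "x \<in> carrier_vec n" "j < m"
  shows "(A\<^sup>T *\<^sub>v x) $ j = (\<Sum>i<n. x $ i * A $$ (i, j))"
  using assms by (auto simp: scalar_prod_def atLeast0LessThan mult.commute intro!: sum.cong)

lemma primal_feasible_iff:
  assumes "A \<in> carrier_mat n m" "c \<in> carrier_vec n"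
  shows "y \<in> primal_feasible A c \<longleftrightarrow> y \<in> carrier_vec m \<and> (\<forall>j<m. 0 \<le> y $ j) \<and>
    (\<forall>i<n. (\<Sum>j<m. A $$ (i, j) * y $ j) \<le> c $ i)"
proof (cases "y \<in> carrier_vec m")
  case True
  have "dim_row A = n" "dim_col A = m" "dim_vec c = n" using assms by auto
  with True show ?thesis
    unfolding primal_feasible_def less_eq_vec_def
    by (simp add: mult_mat_vec_nth[OF assms(1)] conj_commute del: index_mult_mat_vec)
qed (use assms in \<open>simp add: primal_feasible_def\<close>)

lemma dual_feasible_iff:
  assumes "A \<in> carrier_mat n m" "b \<in> carrier_vec m"
  shows "x \<in> dual_feasible A b \<longleftrightarrow> x \<in> carrier_vec n \<and> (\<forall>i<n. 0 \<le> x $ i) \<and>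
    (\<forall>j<m. b $ j \<le> (\<Sum>i<n. x $ i * A $$ (i, j)))"
proof (cases "x \<in> carrier_vec n")
  case True
  have "dim_row A = n" "dim_col A = m" "dim_vec b = m" using assms by auto
  with True show ?thesis
    unfolding dual_feasible_def less_eq_vec_def
    by (simp add: transpose_mult_vec_nth[OF assms(1)] conj_commute del: index_mult_mat_vec)
qed (use assms in \<open>simp add: dual_feasible_def\<close>)

lemma scalar_prod_sum:
  "w \<in> carrier_vec k \<Longrightarrow> v \<bullet> w = (\<Sum>j<k. v $ j * w $ j)"
  by (auto simp: scalar_prod_def atLeast0LessThan)

text \<open>For a real \<open>v\<close> above the primal value, the constraints together with
  \<open>b \<bullet> y \<ge> v\<close> are infeasible; the Farkas certificate, normalised by the
  multiplier of the added row, is a dual solution of cost at most \<open>v\<close>.\<close>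

lemma strong_duality:
  assumes A: "A \<in> carrier_mat n m" and b: "b \<in> carrier_vec m" and c: "c \<in> carrier_vec n"
    and feas: "primal_feasible A c \<noteq> {}"
  shows "dual_value A b c \<le> primal_value A b c"
proof (rule dense_ge)
  fix w assume w: "primal_value A b c < w"
  obtain y where "y \<in> primal_feasible A c" using feas by blast
  then have "ereal (b \<bullet> y) \<le> primal_value A b c"
    unfolding primal_value_def by (rule SUP_upper)
  show "dual_value A b c \<le> w"
  proof (cases w)
    case (real v)
    have lt: "b \<bullet> y < v" if "y \<in> primal_feasible A c" for y
    proof -
      have "ereal (b \<bullet> y) \<le> primal_value A b c"
        unfolding primal_value_def using that by (rule SUP_upper)
      with w real show ?thesis by (metis le_less_trans less_ereal.simps(1))
    qed
    \<comment> \<open>Row \<open>n\<close> demands objective value at least \<open>v\<close>,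
      negated to fit the form of \<open>farkas\<close>.\<close>
    define A' where "A' = (\<lambda>i j. if i < n then A $$ (i, j) else - b $ j)"
    define c' where "c' = (\<lambda>i. if i < n then c $ i else - v)"
    have "\<not> (\<exists>y. (\<forall>j<m. 0 \<le> y j) \<and> (\<forall>i<Suc n. (\<Sum>j<m. A' i j * y j) \<le> c' i))"
    proof
      assume "\<exists>y. (\<forall>j<m. 0 \<le> y j) \<and> (\<forall>i<Suc n. (\<Sum>j<m. A' i j * y j) \<le> c' i)"
      then obtain y where y: "\<forall>j<m. 0 \<le> y j" "\<And>i. i < Suc n \<Longrightarrow> (\<Sum>j<m. A' i j * y j) \<le> c' i"
        by blast
      have "vec m y \<in> primal_feasible A c"
        using y(1) y(2)[OF less_SucI] by (auto simp: primal_feasible_iff[OF A c] A'_def c'_def)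
      from lt[OF this] y(2)[of n] show False
        by (simp add: scalar_prod_sum[of _ m] A'_def c'_def sum_negf)
    qed
    from farkas[OF this] obtain x where x: "\<And>i. i < Suc n \<Longrightarrow> 0 \<le> x i"
      "\<And>j. j < m \<Longrightarrow> 0 \<le> (\<Sum>i<Suc n. x i * A' i j)" "(\<Sum>i<Suc n. x i * c' i) < 0"
      by blast
    have xA: "x n * b $ j \<le> (\<Sum>i<n. x i * A $$ (i, j))" if "j < m" for j
      using x(2)[OF that] by (simp add: A'_def)
    have xc: "(\<Sum>i<n. x i * c $ i) < x n * v" using x(3) by (simp add: c'_def)
    \<comment> \<open>With multiplier zero the certificate would refute the primal constraints
      alone, against feasibility.\<close>
    have "x n \<noteq> 0"
    proof
      assume xn: "x n = 0"
      from feas obtain y where "y \<in> primal_feasible A c" by blast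
      then have y: "\<forall>j<m. 0 \<le> y $ j" "\<forall>i<n. (\<Sum>j<m. A $$ (i, j) * y $ j) \<le> c $ i"
        by (auto simp: primal_feasible_iff[OF A c])
      have "0 \<le> (\<Sum>j<m. (\<Sum>i<n. x i * A $$ (i, j)) * y $ j)"
        using xA xn y(1) by (auto intro!: sum_nonneg)
      also have "\<dots> = (\<Sum>i<n. x i * (\<Sum>j<m. A $$ (i, j) * y $ j))" by (rule sum_bilinear_swap)
      also have "\<dots> \<le> (\<Sum>i<n. x i * c $ i)"
        using y(2) x(1) by (auto intro!: sum_mono mult_left_mono)
      finally show False using xc xn by simp
    qed
    with x(1)[of n] have pos: "0 < x n" by simp
    define x' where "x' = vec n (\<lambda>i. x i / x n)"
    have "x' \<in> dual_feasible A b"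
      using x(1) xA pos
      by (auto simp: dual_feasible_iff[OF A b] x'_def sum_divide_distrib[symmetric] field_simps)
    then have "dual_value A b c \<le> ereal (c \<bullet> x')"
      unfolding dual_value_def by (rule INF_lower)
    also have "c \<bullet> x' \<le> v"
      using xc pos
      by (simp add: scalar_prod_sum[of _ n] x'_def sum_divide_distrib[symmetric] field_simps)
    finally show ?thesis using real by simp
  qed (use w in auto)
qed

section \<open>Attainment of the game value\<close>

lemma prob_simplex_iff:
  "y \<in> prob_simplex k \<longleftrightarrow> y \<in> carrier_vec k \<and> (\<forall>j<k. 0 \<le> y $ j) \<and> (\<Sum>j<k. y $ j) = 1"
  by (auto simp: prob_simplex_def less_eq_vec_def entry_sum_def)

text \<open>\<open>LEAST\<close> on the reals is informative only when a minimum exists, so the set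
  \<open>V\<close> of achievable bounds is shown to contain its infimum.\<close>

lemma game_value_is_least:
  assumes M: "M \<in> carrier_mat k l" and k: "0 < k" and l: "0 < l"
  shows game_value_attained:
      "\<exists>y \<in> prob_simplex l. M *\<^sub>v y \<le> game_value M \<cdot>\<^sub>v all_ones k"
    and game_value_le: "y \<in> prob_simplex l \<Longrightarrow> M *\<^sub>v y \<le> v \<cdot>\<^sub>v all_ones k \<Longrightarrow> game_value M \<le> v"
proof -
  define V where "V = {v. \<exists>y \<in> prob_simplex l. M *\<^sub>v y \<le> v \<cdot>\<^sub>v all_ones k}"
  have mem: "(M *\<^sub>v y \<le> v \<cdot>\<^sub>v all_ones k) \<longleftrightarrow> (\<forall>i<k. (\<Sum>j<l. M $$ (i, j) * y $ j) \<le> v)"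
    if "y \<in> prob_simplex l" for y v
  proof -
    have "y \<in> carrier_vec l" "dim_row M = k" using M that by (auto simp: prob_simplex_iff)
    then show ?thesis
      unfolding less_eq_vec_def all_ones_def
      by (simp add: mult_mat_vec_nth[OF M] del: index_mult_mat_vec)
  qed
  have bdd: "bdd_below V"
  \<comment> \<open>Row 0 alone suffices, since the entries of a mixed strategy lie between 0 and
    1.\<close>
  proof (rule bdd_belowI[of _ "- (\<Sum>j<l. \<bar>M $$ (0, j)\<bar>)"])
    fix v assume "v \<in> V"
    then obtain y where y: "y \<in> prob_simplex l" "M *\<^sub>v y \<le> v \<cdot>\<^sub>v all_ones k" by (auto simp: V_def)
    have "y $ j \<le> 1" if "j < l" for j
      using y(1) that member_le_sum[of j "{..<l}" "\<lambda>j. y $ j"] by (auto simp: prob_simplex_iff)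
    then have "- \<bar>M $$ (0, j)\<bar> \<le> M $$ (0, j) * y $ j" if "j < l" for j
      using y(1) that mult_left_le[of "y $ j" "\<bar>M $$ (0, j)\<bar>"]
        abs_ge_minus_self[of "M $$ (0, j) * y $ j"]
      by (auto simp: prob_simplex_iff abs_mult)
    then have "- (\<Sum>j<l. \<bar>M $$ (0, j)\<bar>) \<le> (\<Sum>j<l. M $$ (0, j) * y $ j)"
      unfolding sum_negf[symmetric] by (intro sum_mono) auto
    also have "\<dots> \<le> v" using y k mem by auto
    finally show "- (\<Sum>j<l. \<bar>M $$ (0, j)\<bar>) \<le> v" .
  qed
  \<comment> \<open>If \<open>Inf V\<close> were not attained, its Farkas certificate would also exclude all slightly larger values.\<close>
  have "Inf V \<in> V"
  proof (rule ccontr)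
    assume "Inf V \<notin> V"
    \<comment> \<open>Rows \<open>k\<close> and \<open>Suc k\<close> encode that the entries sum to
      1, as two opposite inequalities.\<close>
    define M' where "M' = (\<lambda>i j. if i < k then M $$ (i, j) else if i = k then 1 else -1)"
    define c' where "c' = (\<lambda>i. if i < k then Inf V else if i = k then 1 else -1)"
    have "\<not> (\<exists>y. (\<forall>j<l. 0 \<le> y j) \<and> (\<forall>i<Suc (Suc k). (\<Sum>j<l. M' i j * y j) \<le> c' i))"
    proof
      assume "\<exists>y. (\<forall>j<l. 0 \<le> y j) \<and> (\<forall>i<Suc (Suc k). (\<Sum>j<l. M' i j * y j) \<le> c' i)"
      then obtain y where y: "\<forall>j<l. 0 \<le> y j"
        "\<And>i. i < Suc (Suc k) \<Longrightarrow> (\<Sum>j<l. M' i j * y j) \<le> c' i"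
        by blast
      have *: "vec l y \<in> prob_simplex l"
        using y(1) y(2)[of k] y(2)[of "Suc k"] by (auto simp: prob_simplex_iff M'_def c'_def sum_negf)
      have "M *\<^sub>v vec l y \<le> Inf V \<cdot>\<^sub>v all_ones k"
        using y(2)[OF less_SucI[OF less_SucI]] by (auto simp: mem[OF *] M'_def c'_def)
      with * \<open>Inf V \<notin> V\<close> show False by (auto simp: V_def)
    qed
    from farkas[OF this] obtain x where x: "\<And>i. i < Suc (Suc k) \<Longrightarrow> 0 \<le> x i"
      "\<And>j. j < l \<Longrightarrow> 0 \<le> (\<Sum>i<Suc (Suc k). x i * M' i j)"
      "(\<Sum>i<Suc (Suc k). x i * c' i) < 0"
      by blast
    \<comment> \<open>\<open>u\<close> is the net multiplier of the sum constraint and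
      \<open>X\<close> the total weight on the game rows. The certificate says
      \<open>X * Inf V < u\<close>, whereas averaging over a strategy gives
      \<open>u \<le> X * v\<close> for every \<open>v\<close> in \<open>V\<close>.\<close>
    define u where "u = x (Suc k) - x k"
    define X where "X = (\<Sum>i<k. x i)"
    have X0: "0 \<le> X" using x(1) by (auto simp: X_def intro!: sum_nonneg)
    have xM: "u \<le> (\<Sum>i<k. x i * M $$ (i, j))" if "j < l" for j
      using x(2)[OF that] by (simp add: M'_def u_def)
    have xc: "X * Inf V < u" using x(3) by (simp add: c'_def u_def X_def sum_distrib_right)
    have bound: "u \<le> X * v" if "v \<in> V" for v
    proof -
      from that obtain y where y: "y \<in> prob_simplex l" "M *\<^sub>v y \<le> v \<cdot>\<^sub>v all_ones k"
        by (auto simp: V_def)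
      have "u = (\<Sum>j<l. u * y $ j)"
        using y(1) by (simp add: prob_simplex_iff sum_distrib_left[symmetric])
      also have "\<dots> \<le> (\<Sum>j<l. (\<Sum>i<k. x i * M $$ (i, j)) * y $ j)"
        using xM y(1) by (auto simp: prob_simplex_iff intro!: sum_mono mult_right_mono)
      also have "\<dots> = (\<Sum>i<k. x i * (\<Sum>j<l. M $$ (i, j) * y $ j))" by (rule sum_bilinear_swap)
      also have "\<dots> \<le> (\<Sum>i<k. x i * v)"
        using x(1) y mem by (auto intro!: sum_mono mult_left_mono)
      finally show ?thesis by (simp add: X_def sum_distrib_right)
    qed
    have "V \<noteq> {}"
    proof -
      have u: "unit_vec l 0 \<in> prob_simplex l" using l by (auto simp: prob_simplex_iff)
      have "M $$ (i, 0) \<le> (\<Sum>i<k. \<bar>M $$ (i, 0)\<bar>)" if "i < k" for i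
        using that member_le_sum[of i "{..<k}" "\<lambda>i. \<bar>M $$ (i, 0)\<bar>"] by auto
      then have "M *\<^sub>v unit_vec l 0 \<le> (\<Sum>i<k. \<bar>M $$ (i, 0)\<bar>) \<cdot>\<^sub>v all_ones k"
        using l by (simp add: mem[OF u] if_distrib[of "\<lambda>x. _ * x"] cong: if_cong)
      with u show ?thesis by (auto simp: V_def)
    qed
    show False
    proof (cases "X = 0")
      case True
      with xc bound \<open>V \<noteq> {}\<close> show False by force
    next
      case False
      with X0 have "0 < X" by simp
      then have "u / X \<le> Inf V"
        using bound \<open>V \<noteq> {}\<close> by (intro cInf_greatest) (auto simp: field_simps)
      with xc \<open>0 < X\<close> show False by (simp add: field_simps)
    qed
  qed
  moreover have "game_value M = Inf V"
    unfolding game_value_def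
  proof (rule Least_equality)
    show "\<exists>y\<in>prob_simplex (dim_col M). M *\<^sub>v y \<le> Inf V \<cdot>\<^sub>v all_ones (dim_row M)"
      using \<open>Inf V \<in> V\<close> M by (auto simp: V_def)
  qed (use M bdd in \<open>auto simp: V_def intro!: cInf_lower\<close>)
  ultimately show "\<exists>y \<in> prob_simplex l. M *\<^sub>v y \<le> game_value M \<cdot>\<^sub>v all_ones k"
    and "y \<in> prob_simplex l \<Longrightarrow> M *\<^sub>v y \<le> v \<cdot>\<^sub>v all_ones k \<Longrightarrow> game_value M \<le> v"
    using cInf_lower[OF _ bdd] by (auto simp: V_def)
qed

section \<open>The game matrix of the linear program\<close>

lemma lp_game_matrix_carrier:
  "A \<in> carrier_mat n m \<Longrightarrow> lp_game_matrix A b c R \<alpha> \<in> carrier_mat (n + 3) (m + 2)"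
  by (auto simp: lp_game_matrix_def Let_def)

lemma all_less_add3:
  "(\<forall>i<n + 3. P i) \<longleftrightarrow> P 0 \<and> P 1 \<and> P 2 \<and> (\<forall>i<n. P (i + 3))" for n :: nat
  by (simp add: numeral_2_eq_2 numeral_3_eq_3 All_less_Suc2)

text \<open>Translates the block matrix into scalar inequalities, so that the later arguments need
  no further matrix computation. The columns split into the LP variables \<open>y\<close>, a slack
  \<open>s\<close> and a homogenising weight \<open>t\<close>.\<close>

lemma lp_game_matrix_le_iff:
  assumes A: "A \<in> carrier_mat n m" and b: "b \<in> carrier_vec m" and y: "y \<in> carrier_vec m"
  shows "lp_game_matrix A b c R \<alpha> *\<^sub>v (y @\<^sub>v vec_of_list [s, t]) \<le> v \<cdot>\<^sub>v all_ones (n + 3) \<longleftrightarrow>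
    (\<Sum>j<m. y $ j) + s - t \<le> v \<and> t - (\<Sum>j<m. y $ j) - s \<le> v \<and>
    \<alpha> / R * t - b \<bullet> y \<le> v \<and>
    (\<forall>i<n. (\<Sum>j<m. A $$ (i, j) * y $ j) - c $ i / R * t \<le> v)"
proof -
  let ?M = "lp_game_matrix A b c R \<alpha>" and ?y = "y @\<^sub>v vec_of_list [s, t]"
  have sp: "(w @\<^sub>v vec_of_list [p, q]) \<bullet> ?y = w \<bullet> y + (p * s + q * t)"
    if "w \<in> carrier_vec m" for w p q
  proof -
    have "vec_of_list [a, b] \<in> carrier_vec 2" for a b :: real
      by (rule carrier_vecI) simp
    then have "(w @\<^sub>v vec_of_list [p, q]) \<bullet> ?y = w \<bullet> y + vec_of_list [p, q] \<bullet> vec_of_list [s, t]"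
      using scalar_prod_append[OF that _ y] by blast
    also have "vec_of_list [p, q] \<bullet> vec_of_list [s, t] = p * s + q * t"
      by (simp add: scalar_prod_def numeral_2_eq_2)
    finally show ?thesis .
  qed
  let ?rs = "[all_ones m @\<^sub>v vec_of_list [1, -1], (- all_ones m) @\<^sub>v vec_of_list [-1, 1],
      (- b) @\<^sub>v vec_of_list [0, \<alpha> / R]] @
      map (\<lambda>i. row A i @\<^sub>v vec_of_list [0, - (c $ i) / R]) [0..<n]"
  have M: "?M = mat_of_rows (m + 2) ?rs"
    using A by (simp add: lp_game_matrix_def Let_def)
  have dims: "dim_vec w = m + 2" if "w \<in> set ?rs" for w
    using A b that by (auto simp: all_ones_def)
  have row: "row ?M i = ?rs ! i" if "i < n + 3" for i
  proof -
    have i: "i < length ?rs" using that by simp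
    then have "?rs ! i \<in> carrier_vec (m + 2)" by (intro carrier_vecI dims nth_mem)
    then show ?thesis unfolding M by (rule mat_of_rows_row[OF i])
  qed
  have rows: "row ?M 0 = all_ones m @\<^sub>v vec_of_list [1, -1]"
    "row ?M 1 = (- all_ones m) @\<^sub>v vec_of_list [-1, 1]"
    "row ?M 2 = (- b) @\<^sub>v vec_of_list [0, \<alpha> / R]"
    by (simp_all add: row)
  have rows': "row ?M (i + 3) = row A i @\<^sub>v vec_of_list [0, - (c $ i) / R]" if "i < n" for i
    using that by (simp add: row nth_append)
  have e: "all_ones m \<in> carrier_vec m" "all_ones m \<bullet> y = (\<Sum>j<m. y $ j)"
    using y by (auto simp: all_ones_def scalar_prod_sum)
  have A_row: "row A i \<bullet> y = (\<Sum>j<m. A $$ (i, j) * y $ j)" if "i < n" for i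
    using A y that mult_mat_vec_nth[OF A y that] by simp
  have "(?M *\<^sub>v ?y \<le> v \<cdot>\<^sub>v all_ones (n + 3)) \<longleftrightarrow> (\<forall>i<n+3. row ?M i \<bullet> ?y \<le> v)"
    using lp_game_matrix_carrier[OF A, of b c R \<alpha>] by (auto simp: less_eq_vec_def all_ones_def)
  also have "\<dots> \<longleftrightarrow> row ?M 0 \<bullet> ?y \<le> v \<and> row ?M 1 \<bullet> ?y \<le> v \<and> row ?M 2 \<bullet> ?y \<le> v \<and>
      (\<forall>i<n. row ?M (i + 3) \<bullet> ?y \<le> v)"
    by (rule all_less_add3)
  also have "\<dots> \<longleftrightarrow> (\<Sum>j<m. y $ j) + s - t \<le> v \<and> t - (\<Sum>j<m. y $ j) - s \<le> v \<and>
      \<alpha> / R * t - b \<bullet> y \<le> v \<and>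
      (\<forall>i<n. (\<Sum>j<m. A $$ (i, j) * y $ j) - c $ i / R * t \<le> v)"
  proof -
    have "row ?M 0 \<bullet> ?y = (\<Sum>j<m. y $ j) + s - t"
      "row ?M 1 \<bullet> ?y = t - (\<Sum>j<m. y $ j) - s"
      "row ?M 2 \<bullet> ?y = \<alpha> / R * t - b \<bullet> y"
      unfolding rows sp[OF e(1)] sp[OF uminus_carrier_vec[THEN iffD2, OF e(1)]]
        sp[OF uminus_carrier_vec[THEN iffD2, OF b]]
      using b y e by simp_all
    moreover have "row ?M (i + 3) \<bullet> ?y = (\<Sum>j<m. A $$ (i, j) * y $ j) - c $ i / R * t"
      if "i < n" for i
    proof -
      have "row A i \<in> carrier_vec m" using A by auto
      then show ?thesis unfolding rows'[OF that] by (simp add: sp A_row[OF that] del: vec_of_list_Cons)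
    qed
    ultimately show ?thesis by auto
  qed
  finally show ?thesis .
qed

lemma append_in_prob_simplex_iff:
  assumes y: "y \<in> carrier_vec m"
  shows "y @\<^sub>v vec_of_list [s, t] \<in> prob_simplex (m + 2) \<longleftrightarrow>
    (\<forall>j<m. 0 \<le> y $ j) \<and> 0 \<le> s \<and> 0 \<le> t \<and> (\<Sum>j<m. y $ j) + s + t = 1"
proof -
  define w where "w = y @\<^sub>v vec_of_list [s, t]"
  have dim: "dim_vec y = m" using y by simp
  have nth: "w $ j = y $ j" if "j < m" for j using dim that by (simp add: w_def)
  have nth': "w $ m = s" "w $ Suc m = t" using dim by (simp_all add: w_def)
  have "w \<in> carrier_vec (m + 2)" by (rule carrier_vecI) (simp add: w_def dim)
  moreover have "(\<forall>j<m+2. 0 \<le> w $ j) \<longleftrightarrow> (\<forall>j<m. 0 \<le> y $ j) \<and> 0 \<le> s \<and> 0 \<le> t"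
    using nth nth' by (auto simp: less_Suc_eq)
  moreover have "(\<Sum>j<m+2. w $ j) = (\<Sum>j<m. y $ j) + s + t"
    using nth nth' by simp
  ultimately show ?thesis unfolding w_def[symmetric] by (simp add: prob_simplex_iff)
qed

section \<open>Comparison of the game value with the optimal value\<close>

lemma game_value_nonpos:
  assumes lp: "lp_assumptions n m A b c R r" and \<alpha>: "ereal \<alpha> \<le> primal_value A b c"
  shows "game_value (lp_game_matrix A b c R \<alpha>) \<le> 0"
proof (rule field_le_epsilon)
  fix \<eta> :: real assume \<eta>: "0 < \<eta>"
  have A: "A \<in> carrier_mat n m" and b: "b \<in> carrier_vec m" and c: "c \<in> carrier_vec n" and R: "0 < R"
    and bounded: "bounded_primal_value A b c R = primal_value A b c"
    using lp by (auto simp: lp_assumptions_def)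
  \<comment> \<open>The supremum is approached without assuming that it is attained; scaling by
    \<open>1 / (2 * R)\<close> turns the deficit \<open>2 * R * \<eta>\<close> into
    \<open>\<eta>\<close>.\<close>
  have "ereal (\<alpha> - 2 * R * \<eta>) < bounded_primal_value A b c R"
    unfolding bounded using \<alpha> \<eta> R by (elim less_le_trans[rotated]) simp
  then obtain y where y: "y \<in> primal_feasible A c" "entry_sum y \<le> R" "\<alpha> - 2 * R * \<eta> < b \<bullet> y"
    by (auto simp: bounded_primal_value_def less_SUP_iff)
  then have y': "y \<in> carrier_vec m" "\<forall>j<m. 0 \<le> y $ j"
      "\<And>i. i < n \<Longrightarrow> (\<Sum>j<m. A $$ (i, j) * y $ j) \<le> c $ i" "(\<Sum>j<m. y $ j) \<le> R"
    by (auto simp: primal_feasible_iff[OF A c] entry_sum_def)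
  define z where "z = vec m (\<lambda>j. y $ j / (2 * R))"
  have z: "z \<in> carrier_vec m" by (simp add: z_def)
  have sum_z: "(\<Sum>j<m. z $ j) = (\<Sum>j<m. y $ j) / (2 * R)"
    by (simp add: z_def sum_divide_distrib)
  \<comment> \<open>The slack fills the first \<open>m + 1\<close> entries up to mass 1/2, matching
    the last entry, so the first two rows evaluate to 0. It is nonnegative because \<open>y\<close>
    has entry sum at most \<open>R\<close>.\<close>
  define s where "s = 1 / 2 - (\<Sum>j<m. z $ j)"
  have "0 \<le> s" using y' R by (simp add: s_def sum_z field_simps)
  then have simplex: "z @\<^sub>v vec_of_list [s, 1 / 2] \<in> prob_simplex (m + 2)"
    unfolding append_in_prob_simplex_iff[OF z] using y'(2) R by (simp add: s_def z_def)
  have bz: "b \<bullet> z = b \<bullet> y / (2 * R)"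
    using y' z by (simp add: scalar_prod_sum z_def sum_divide_distrib)
  have Az: "(\<Sum>j<m. A $$ (i, j) * z $ j) = (\<Sum>j<m. A $$ (i, j) * y $ j) / (2 * R)" for i
    by (simp add: z_def sum_divide_distrib)
  have "(\<Sum>j<m. A $$ (i, j) * z $ j) - c $ i / R * (1 / 2) \<le> \<eta>" if "i < n" for i
  proof -
    have "(\<Sum>j<m. A $$ (i, j) * z $ j) \<le> c $ i / (2 * R)"
      unfolding Az using y'(3)[OF that] R by (intro divide_right_mono) auto
    with \<eta> show ?thesis by simp
  qed
  moreover have "\<alpha> / R * (1 / 2) - b \<bullet> z \<le> \<eta>"
    using y(3) R by (simp add: bz field_simps)
  ultimately have "lp_game_matrix A b c R \<alpha> *\<^sub>v (z @\<^sub>v vec_of_list [s, 1 / 2])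
      \<le> \<eta> \<cdot>\<^sub>v all_ones (n + 3)"
    unfolding lp_game_matrix_le_iff[OF A b z] using \<eta> by (simp add: s_def)
  from game_value_le[OF lp_game_matrix_carrier[OF A] _ _ simplex this]
  show "game_value (lp_game_matrix A b c R \<alpha>) \<le> 0 + \<eta>" by simp
qed

lemma vec_split_last_two:
  assumes "w \<in> carrier_vec (m + 2)"
  obtains y s t where "y \<in> carrier_vec m" "w = y @\<^sub>v vec_of_list [s, t]"
proof
  show "vec m (\<lambda>j. w $ j) \<in> carrier_vec m" by simp
  show "w = vec m (\<lambda>j. w $ j) @\<^sub>v vec_of_list [w $ m, w $ Suc m]"
    using assms by (intro eq_vecI) (auto simp: less_Suc_eq)
qed

text \<open>An optimal strategy satisfies the scaled LP constraints only up to \<open>v\<close>, so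
  it yields no feasible primal point directly. A dual solution of entry sum at most \<open>r\<close>
  prices these violations at no more than \<open>r * v\<close>, which bounds the dual value from
  below.\<close>

lemma primal_value_ge:
  assumes lp: "lp_assumptions n m A b c R r" and \<alpha>: "\<alpha> \<le> R"
    and gv: "game_value (lp_game_matrix A b c R \<alpha>) \<le> v"
  shows "ereal (\<alpha> - 3 * R * (r + 1) * v) \<le> primal_value A b c"
proof -
  have A: "A \<in> carrier_mat n m" and b: "b \<in> carrier_vec m" and c: "c \<in> carrier_vec n" and R: "0 < R"
    and r: "0 \<le> r"
    and feas: "primal_feasible A c \<noteq> {}"
    and bounded: "bounded_dual_value A b c r = dual_value A b c"
    and cR: "\<And>i. i < n \<Longrightarrow> \<bar>c $ i\<bar> \<le> R"
    using lp by (auto simp: lp_assumptions_def)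
  let ?M = "lp_game_matrix A b c R \<alpha>"
  have "\<exists>w \<in> prob_simplex (m + 2). ?M *\<^sub>v w \<le> game_value ?M \<cdot>\<^sub>v all_ones (n + 3)"
    by (rule game_value_attained[OF lp_game_matrix_carrier[OF A]]) simp_all
  then obtain w where w: "w \<in> prob_simplex (m + 2)"
    "?M *\<^sub>v w \<le> game_value ?M \<cdot>\<^sub>v all_ones (n + 3)"
    by blast
  from w(1) have "w \<in> carrier_vec (m + 2)" by (simp add: prob_simplex_iff)
  then obtain y s t where y: "y \<in> carrier_vec m" and w_eq: "w = y @\<^sub>v vec_of_list [s, t]"
    by (rule vec_split_last_two)
  have pos: "\<forall>j<m. 0 \<le> y $ j" "0 \<le> t" and sum: "(\<Sum>j<m. y $ j) + s + t = 1"
    using w(1) unfolding w_eq append_in_prob_simplex_iff[OF y] by auto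
  have g: "(\<Sum>j<m. y $ j) + s - t \<le> game_value ?M" "t - (\<Sum>j<m. y $ j) - s \<le> game_value ?M"
    "\<alpha> / R * t - b \<bullet> y \<le> game_value ?M"
    "\<And>i. i < n \<Longrightarrow> (\<Sum>j<m. A $$ (i, j) * y $ j) - c $ i / R * t \<le> game_value ?M"
    using w(2) unfolding w_eq lp_game_matrix_le_iff[OF A b y] by blast+
  \<comment> \<open>The first \<open>m + 1\<close> entries have total mass \<open>1 - t\<close>. In
    particular \<open>v\<close> is nonnegative.\<close>
  have balance: "\<bar>1 - 2 * t\<bar> \<le> v" using g(1,2) sum gv unfolding abs_le_iff by linarith
  have yb: "\<alpha> / R * t - b \<bullet> y \<le> v" using g(3) gv by linarith
  have Ay: "(\<Sum>j<m. A $$ (i, j) * y $ j) \<le> v + c $ i / R * t" if "i < n" for i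
    using g(4)[OF that] gv by linarith
  have "\<alpha> - 3 * R * (r + 1) * v \<le> c \<bullet> x" if x: "x \<in> dual_feasible A b" "entry_sum x \<le> r" for x
  proof -
    have x': "x \<in> carrier_vec n" "\<forall>i<n. 0 \<le> x $ i" "(\<Sum>i<n. x $ i) \<le> r"
        "\<And>j. j < m \<Longrightarrow> b $ j \<le> (\<Sum>i<n. x $ i * A $$ (i, j))"
      using x by (auto simp: dual_feasible_iff[OF A b] entry_sum_def)
    have cx: "c \<bullet> x = (\<Sum>i<n. x $ i * c $ i)" using x'(1) by (simp add: scalar_prod_sum mult.commute)
    show ?thesis
    \<comment> \<open>At this threshold, dividing by \<open>t\<close> costs at most the factor 3,
      while a smaller \<open>t\<close> forces \<open>v > 1 / 3\<close> by
      \<open>balance\<close>.\<close>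
    proof (cases "t \<ge> 1 / 3")
      case True
      \<comment> \<open>Weak duality with each right-hand side relaxed by \<open>v\<close>.\<close>
      have "b \<bullet> y \<le> (\<Sum>j<m. (\<Sum>i<n. x $ i * A $$ (i, j)) * y $ j)"
        using x'(4) pos by (auto simp: scalar_prod_sum[OF y] intro!: sum_mono mult_right_mono)
      also have "\<dots> = (\<Sum>i<n. x $ i * (\<Sum>j<m. A $$ (i, j) * y $ j))" by (rule sum_bilinear_swap)
      also have "\<dots> \<le> (\<Sum>i<n. x $ i * (v + c $ i / R * t))"
        using x'(2) Ay by (auto intro!: sum_mono mult_left_mono)
      also have "\<dots> = (\<Sum>i<n. x $ i) * v + (c \<bullet> x) / R * t"
        by (simp add: cx sum.distrib sum_distrib_left sum_distrib_right sum_divide_distrib algebra_simps)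
      also have "\<dots> \<le> r * v + (c \<bullet> x) / R * t"
        using x'(3) balance by (auto intro!: mult_right_mono)
      finally have "\<alpha> / R * t - v \<le> r * v + (c \<bullet> x) / R * t" using yb by linarith
      then have "(\<alpha> - c \<bullet> x) * t / R \<le> (r + 1) * v"
        by (simp add: diff_divide_distrib algebra_simps)
      then have *: "(\<alpha> - c \<bullet> x) * t \<le> R * (r + 1) * v"
        using R by (simp add: pos_divide_le_eq mult_ac)
      have "0 \<le> R * (r + 1) * v" using R r balance by auto
      show ?thesis
      \<comment> \<open>The lower bound on \<open>t\<close> helps only when
        \<open>\<alpha> - c \<bullet> x\<close> is positive; otherwise the claim is
        immediate.\<close>
      proof (cases "\<alpha> \<le> c \<bullet> x")
        case True
        with \<open>0 \<le> R * (r + 1) * v\<close> show ?thesis by simp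
      next
        case False
        then have "(\<alpha> - c \<bullet> x) * (1 / 3) \<le> (\<alpha> - c \<bullet> x) * t"
          using \<open>t \<ge> 1 / 3\<close> by (intro mult_left_mono) auto
        with * show ?thesis by simp
      qed
    next
      case False
      then have "1 \<le> 3 * v" using balance by simp
      then have "R * (r + 1) * 1 \<le> R * (r + 1) * (3 * v)" using R r by (intro mult_left_mono) auto
      then have "\<alpha> - 3 * R * (r + 1) * v \<le> - R * r" using \<alpha> by (simp add: algebra_simps)
      also have "- R * r \<le> - R * (\<Sum>i<n. x $ i)" using x'(3) R by simp
      also have "\<dots> = (\<Sum>i<n. x $ i * (- R))"
        by (simp add: sum_distrib_left sum_negf mult.commute)
      also have "\<dots> \<le> c \<bullet> x"
        unfolding cx using x'(2) cR by (intro sum_mono mult_left_mono) (force simp: abs_le_iff)+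
      finally show ?thesis .
    qed
  qed
  then have "ereal (\<alpha> - 3 * R * (r + 1) * v) \<le> bounded_dual_value A b c r"
    unfolding bounded_dual_value_def by (auto intro!: INF_greatest)
  also have "\<dots> \<le> primal_value A b c"
    unfolding bounded by (rule strong_duality[OF A b c feas])
  finally show ?thesis .
qed

theorem lemma12:
  shows "\<exists>decide :: real \<Rightarrow> real \<Rightarrow> bool.
    \<forall>n m A b c R r \<alpha> \<epsilon> l.
      lp_assumptions n m A b c R r \<longrightarrow> -R \<le> \<alpha> \<longrightarrow> \<alpha> \<le> R \<longrightarrow> 0 < \<epsilon> \<longrightarrow>
      (let \<delta> = \<epsilon> / (6 * R * (r + 1)) in
       \<bar>l - game_value (lp_game_matrix A b c R \<alpha>)\<bar> \<le> \<delta> \<longrightarrow>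
       (if decide \<delta> l
        then primal_value A b c < ereal \<alpha>
        else primal_value A b c \<ge> ereal (\<alpha> - \<epsilon>)))"
proof (intro exI[of _ "\<lambda>\<delta> l. \<delta> < l"] allI impI)
  fix n m :: nat and A :: "real mat" and b c :: "real vec" and R r \<alpha> \<epsilon> l :: real
  assume lp: "lp_assumptions n m A b c R r" and \<alpha>: "\<alpha> \<le> R" and "0 < \<epsilon>"
  define \<delta> where "\<delta> = \<epsilon> / (6 * R * (r + 1))"
  have "0 < R" "0 \<le> r" using lp by (auto simp: lp_assumptions_def)
  \<comment> \<open>The constant 6 is the factor 3 from \<open>primal_value_ge\<close> times 2, for
    the threshold \<open>\<delta>\<close> plus the approximation error
    \<open>\<delta>\<close>.\<close>
  then have \<epsilon>: "\<epsilon> = 3 * R * (r + 1) * (2 * \<delta>)" by (simp add: \<delta>_def)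
  let ?g = "game_value (lp_game_matrix A b c R \<alpha>)"
  have "if \<delta> < l then primal_value A b c < ereal \<alpha> else ereal (\<alpha> - \<epsilon>) \<le> primal_value A b c"
    if l: "\<bar>l - ?g\<bar> \<le> \<delta>"
  proof (cases "\<delta> < l")
    case True
    \<comment> \<open>An approximation above \<open>\<delta>\<close> certifies a positive game
      value, and the contrapositive of \<open>game_value_nonpos\<close> applies.\<close>
    with l have "\<not> ?g \<le> 0" by linarith
    with game_value_nonpos[OF lp] True show ?thesis by (metis not_le)
  next
    case False
    with l have "?g \<le> 2 * \<delta>" by linarith
    from primal_value_ge[OF lp \<alpha> this] False \<epsilon> show ?thesis by simp
  qed
  then show "let \<delta> = \<epsilon> / (6 * R * (r + 1)) in \<bar>l - ?g\<bar> \<le> \<delta> \<longrightarrow>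
      (if \<delta> < l then primal_value A b c < ereal \<alpha> else ereal (\<alpha> - \<epsilon>) \<le> primal_value A b c)"
    by (simp add: \<delta>_def)
qed

end
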